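(* Let $X,Y$ be random variables with finite alphabets and joint pmf $p_{X,Y}$, and let $R^*$ be the exact common information between $X$ and $Y$. Then $$G(X;Y)\le R^*<G(X;Y)+1.$$
   Context: All random variables are discrete; $H$ denotes Shannon entropy (base 2). $X\to W\to Y$ means $X$ and $Y$ are conditionally independent given $W$. The common entropy is $G(X;Y)=\min_{W:\,X\to W\to Y}H(W)$, the minimum being over all discrete $W$ jointly distributed with $(X,Y)$ (whose joint pmf is fixed) such that $X\to W\to Y$. A simulation code $(W,R)$ consists of: (i) a discrete common random variable $W\sim p_W$, with $R=\min_{\mathcal C}\mathsf{E}(L)$, where the minimum is over all variable-length prefix-free zero-error (uniquely assigning) binary codes $\mathcal C\subset\{0,1\}^*$ for $W$ and $L$ is the length of the codeword of $W$ (the empty codeword is allowed when $W$ is constant); (ii) stochastic decoders $p_{\hat X|W}$ and $p_{\hat Y|W}$, with $\hat X$ and $\hat Y$ conditionally independent given $W$. The pair $(X,Y)$ is exactly generated by $(W,R)$ if $p_{\hat X,\hat Y}(x,y)=p_{X,Y}(x,y)$ for all $(x,y)$. The exact common information $R^*$ is the infimum of all $R$ such that some simulation code $(W,R)$ exactly generates $(X,Y)$. *)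

theory Defs
  imports "HOL-Probability.Probability" "HOL-Library.Sublist"
begin

section \<open>Shannon entropy and optimal codes of a discrete distribution\<close>

text \<open>
  The entropy in the locale \<^locale>\<open>information_space\<close> is a real number given by a Bochner
  integral, hence it is 0 for a distribution of infinite entropy.  As the quantities below are
  infima over distributions that may have infinite support, entropy is defined here with values
  in \<^typ>\<open>ennreal\<close>; it agrees with the library's one on finite support
  (lemma \<open>shannon_entropy_eq_entropy\<close>).
\<close>

definition shannon_entropy :: "'w pmf \<Rightarrow> ennreal" where
  "shannon_entropy P = (\<integral>\<^sup>+w. ennreal (log 2 (1 / pmf P w)) \<partial>measure_pmf P)"

text \<open>
  Only the symbols of positive probability have to be encoded.  The empty word is a proper prefix
  of every other word, so it is a codeword only if there is a single symbol.
\<close>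

definition prefix_free_code :: "'w pmf \<Rightarrow> ('w \<Rightarrow> bool list) \<Rightarrow> bool" where
  "prefix_free_code P c \<longleftrightarrow> inj_on c (set_pmf P) \<and>
     (\<forall>w\<in>set_pmf P. \<forall>w'\<in>set_pmf P. \<not> strict_prefix (c w) (c w'))"

definition expected_length :: "'w pmf \<Rightarrow> ('w \<Rightarrow> bool list) \<Rightarrow> ennreal" where
  "expected_length P c = (\<integral>\<^sup>+w. of_nat (length (c w)) \<partial>measure_pmf P)"

text \<open>Minima are written as infima in the complete order \<^typ>\<open>ennreal\<close>, here and in
  \<open>common_entropy\<close>.\<close>

definition code_rate :: "'w pmf \<Rightarrow> ennreal" where
  "code_rate P = (INF c \<in> {c. prefix_free_code P c}. expected_length P c)"


section \<open>Common entropy\<close>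

definition markov_chain :: "('a \<times> 'w \<times> 'b) pmf \<Rightarrow> bool" where
  "markov_chain q \<longleftrightarrow> (\<forall>w \<in> set_pmf (map_pmf (\<lambda>(x, w, y). w) q).
     let r = cond_pmf q {(x, w', y) | x w' y. w' = w}
     in map_pmf (\<lambda>(x, w, y). (x, y)) r =
        pair_pmf (map_pmf (\<lambda>(x, w, y). x) r) (map_pmf (\<lambda>(x, w, y). y) r))"

text \<open>
  The support of a pmf is countable and everything below is invariant under injective relabelling
  of \<open>W\<close>, so letting \<open>W\<close> take values in \<^typ>\<open>nat\<close> covers all discrete \<open>W\<close>
  (lemma \<open>common_entropy_le\<close>).
\<close>

definition common_entropy :: "('a \<times> 'b) pmf \<Rightarrow> ennreal" where
  "common_entropy p =
     (INF q \<in> {q :: ('a \<times> nat \<times> 'b) pmf.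
                 map_pmf (\<lambda>(x, w, y). (x, y)) q = p \<and> markov_chain q}.
        shannon_entropy (map_pmf (\<lambda>(x, w, y). w) q))"


section \<open>Exact common information\<close>

text \<open>The pair of decoder outputs; the product expresses that they are independent given \<open>W\<close>.\<close>

definition simulated_pair :: "'w pmf \<Rightarrow> ('w \<Rightarrow> 'a pmf) \<Rightarrow> ('w \<Rightarrow> 'b pmf) \<Rightarrow> ('a \<times> 'b) pmf" where
  "simulated_pair P dX dY = bind_pmf P (\<lambda>w. pair_pmf (dX w) (dY w))"

definition exactly_generated ::
    "('a \<times> 'b) pmf \<Rightarrow> 'w pmf \<Rightarrow> ('w \<Rightarrow> 'a pmf) \<Rightarrow> ('w \<Rightarrow> 'b pmf) \<Rightarrow> bool" where
  "exactly_generated p P dX dY \<longleftrightarrow>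
     (\<forall>x y. pmf (simulated_pair P dX dY) (x, y) = pmf p (x, y))"

definition exact_common_information :: "('a \<times> 'b) pmf \<Rightarrow> ennreal" where
  "exact_common_information p =
     (INF P \<in> {P :: nat pmf. \<exists>dX dY. exactly_generated p P dX dY}. code_rate P)"


section \<open>Consistency of the definitions\<close>

lemma shannon_entropy_eq_entropy:
  fixes P :: "'w pmf"
  assumes fin: "finite (set_pmf P)"
  shows "shannon_entropy P =
    ennreal (prob_space.entropy (measure_pmf P) 2 (count_space UNIV) (\<lambda>w. w))"
proof -
  interpret information_space "measure_pmf P" 2
    by unfold_locales simp
  have "distributed (measure_pmf P) (count_space UNIV) (\<lambda>w. w) (\<lambda>w. ennreal (pmf P w))"
    using measure_pmf_eq_density[of P] distr_id2[of "count_space UNIV" "measure_pmf P"]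
    by (simp add: distributed_def)
  then have "prob_space.entropy (measure_pmf P) 2 (count_space UNIV) (\<lambda>w. w) =
      - (\<integral>w. pmf P w * log 2 (pmf P w) \<partial>count_space UNIV)"
    by (rule entropy_distr) simp
  also have "(\<integral>w. pmf P w * log 2 (pmf P w) \<partial>count_space UNIV) =
      (\<Sum>w\<in>set_pmf P. pmf P w * log 2 (pmf P w))"
    by (rule lebesgue_integral_count_space_finite_support[THEN trans])
       (auto simp: set_pmf_iff intro!: sum.mono_neutral_left finite_subset[OF _ fin])
  also have "- \<dots> = (\<Sum>w\<in>set_pmf P. pmf P w * log 2 (1 / pmf P w))"
    by (simp add: log_divide sum_negf[symmetric] set_pmf_iff)
  finally have "prob_space.entropy (measure_pmf P) 2 (count_space UNIV) (\<lambda>w. w) =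
      (\<Sum>w\<in>set_pmf P. pmf P w * log 2 (1 / pmf P w))" .
  moreover have "shannon_entropy P = ennreal (\<Sum>w\<in>set_pmf P. pmf P w * log 2 (1 / pmf P w))"
  proof -
    have nn: "0 \<le> log 2 (1 / pmf P w)" if "w \<in> set_pmf P" for w
      using that by (simp add: pmf_positive pmf_le_1)
    have "shannon_entropy P = (\<Sum>w\<in>set_pmf P. ennreal (log 2 (1 / pmf P w)) * ennreal (pmf P w))"
      unfolding shannon_entropy_def by (rule nn_integral_measure_pmf_finite[OF fin]) simp
    also have "\<dots> = (\<Sum>w\<in>set_pmf P. ennreal (pmf P w * log 2 (1 / pmf P w)))"
      using nn by (intro sum.cong refl) (simp add: ennreal_mult' mult.commute)
    also have "\<dots> = ennreal (\<Sum>w\<in>set_pmf P. pmf P w * log 2 (1 / pmf P w))"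
      using nn by (intro sum_ennreal mult_nonneg_nonneg) auto
    finally show ?thesis .
  qed
  ultimately show ?thesis by simp
qed

lemma shannon_entropy_map_inj:
  assumes "inj_on f (set_pmf P)"
  shows "shannon_entropy (map_pmf f P) = shannon_entropy P"
  unfolding shannon_entropy_def nn_integral_map_pmf
  by (rule nn_integral_cong_AE) (auto simp: AE_measure_pmf_iff pmf_map_inj[OF assms])

lemma common_entropy_le:
  fixes q :: "('a \<times> 'w \<times> 'b) pmf"
  assumes marg: "map_pmf (\<lambda>(x, w, y). (x, y)) q = p" and mc: "markov_chain q"
  shows "common_entropy p \<le> shannon_entropy (map_pmf (\<lambda>(x, w, y). w) q)"
proof -
  let ?S = "set_pmf (map_pmf (\<lambda>(x, w, y). w) q)"
  define f where "f = to_nat_on ?S"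
  have inj: "inj_on f ?S"
    unfolding f_def by (rule inj_on_to_nat_on) (rule countable_set_pmf)
  define h :: "'a \<times> 'w \<times> 'b \<Rightarrow> 'a \<times> nat \<times> 'b" where "h = (\<lambda>(x, w, y). (x, f w, y))"
  define q' where "q' = map_pmf h q"
  have eq: "shannon_entropy (map_pmf (\<lambda>(x, w, y). w) q') = shannon_entropy (map_pmf (\<lambda>(x, w, y). w) q)"
  proof -
    have "map_pmf (\<lambda>(x, w, y). w) q' = map_pmf f (map_pmf (\<lambda>(x, w, y). w) q)"
      by (simp add: q'_def h_def map_pmf_comp case_prod_unfold)
    with shannon_entropy_map_inj[OF inj] show ?thesis by simp
  qed
  have marg': "map_pmf (\<lambda>(x, w, y). (x, y)) q' = p"
    using marg by (simp add: q'_def h_def map_pmf_comp case_prod_unfold)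
  have "markov_chain q'"
    unfolding markov_chain_def Let_def
  proof
    fix v assume "v \<in> set_pmf (map_pmf (\<lambda>(x, w, y). w) q')"
    then obtain x w y where t: "(x, w, y) \<in> set_pmf q" and v: "v = f w"
      by (auto simp: q'_def h_def)
    have w: "w \<in> ?S" using t by force
    define r where "r = cond_pmf q {(x, w', y) | x w' y. w' = w}"
    have "cond_pmf q' {(x, w', y) | x w' y. w' = v} =
        map_pmf h (cond_pmf q (h -` {(x, w', y) | x w' y. w' = v}))"
      unfolding q'_def by (rule cond_map_pmf) (use t in \<open>force simp: h_def v\<close>)
    also have "cond_pmf q (h -` {(x, w', y) | x w' y. w' = v}) = r"
    proof -
      let ?A = "h -` {(x, w', y) | x w' y. w' = v}" and ?B = "{(x, w', y) | x w' y. w' = w}"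
      have *: "z \<in> ?A \<longleftrightarrow> z \<in> ?B" if "z \<in> set_pmf q" for z
      proof -
        obtain x' u y' where z: "z = (x', u, y')" by (cases z)
        with that have "u \<in> ?S" by force
        then have "f u = f w \<longleftrightarrow> u = w" by (rule inj_on_eq_iff[OF inj _ w])
        then show ?thesis by (simp add: z h_def v)
      qed
      have B: "set_pmf q \<inter> ?B \<noteq> {}" using t by auto
      with * have A: "set_pmf q \<inter> ?A \<noteq> {}" by blast
      have AB: "?A \<inter> set_pmf q = ?B \<inter> set_pmf q" using * by blast
      have m: "measure q ?A = measure q ?B"
        by (rule measure_Int_set_pmf[of q ?A, symmetric, unfolded AB, THEN trans])
           (rule measure_Int_set_pmf)
      show ?thesis
        unfolding r_def
      proof (rule pmf_eqI)
        fix z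
        show "pmf (cond_pmf q ?A) z = pmf (cond_pmf q ?B) z"
        proof (cases "z \<in> set_pmf q")
          case True
          show ?thesis unfolding pmf_cond[OF A] pmf_cond[OF B] m *[OF True] ..
        next
          case False
          then have "pmf q z = 0" by (simp add: set_pmf_iff)
          then show ?thesis unfolding pmf_cond[OF A] pmf_cond[OF B] by simp
        qed
      qed
    qed
    finally have r': "cond_pmf q' {(x, w', y) | x w' y. w' = v} = map_pmf h r" .
    have "map_pmf (\<lambda>(x, w, y). (x, y)) r =
        pair_pmf (map_pmf (\<lambda>(x, w, y). x) r) (map_pmf (\<lambda>(x, w, y). y) r)"
      using mc w unfolding markov_chain_def Let_def r_def by blast
    then show "map_pmf (\<lambda>(x, w, y). (x, y)) (cond_pmf q' {(x, w', y) | x w' y. w' = v}) =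
        pair_pmf (map_pmf (\<lambda>(x, w, y). x) (cond_pmf q' {(x, w', y) | x w' y. w' = v}))
          (map_pmf (\<lambda>(x, w, y). y) (cond_pmf q' {(x, w', y) | x w' y. w' = v}))"
      unfolding r' by (simp add: h_def map_pmf_comp case_prod_unfold)
  qed
  with marg' have "common_entropy p \<le> shannon_entropy (map_pmf (\<lambda>(x, w, y). w) q')"
    unfolding common_entropy_def by (intro INF_lower) simp
  with eq show ?thesis by simp
qed

end

theory Submission
  imports Defs
begin

text \<open>
  Common random variables of simulation codes are exactly the middle variables of Markov chains
  \<open>X \<rightarrow> W \<rightarrow> Y\<close>, so both bounds compare \<open>code_rate P\<close> with \<open>shannon_entropy P\<close>, and the lower one
  is the source coding theorem.  Shannon's code has redundancy less than 1, but as the common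
  entropy is only an infimum the upper bound needs a redundancy bounded away from 1.  This holds
  as soon as some event has probability in \<open>[d, 1 - d]\<close>, with \<open>d\<close> independent of \<open>W\<close>: either
  Shannon's code saves \<open>d/2\<close> already, or its Kraft sum is so close to 1/2 that all codewords
  outside that event can be shortened by one bit.  If no such event exists, then \<open>W\<close> has an atom of
  probability near 1 and \<open>p\<close> is near the product of its marginals; for \<open>p\<close> not a product this bounds
  \<open>d\<close> from below, and for a product a constant \<open>W\<close> needs no bits at all.
\<close>

section \<open>Kraft's inequality and its converse\<close>

lemma prefix_free_code_iff:
  "prefix_free_code P c \<longleftrightarrow> (\<forall>v\<in>set_pmf P. \<forall>w\<in>set_pmf P. prefix (c v) (c w) \<longrightarrow> v = w)"
  unfolding prefix_free_code_def inj_on_def by (metis prefix_order.le_less prefix_order.less_irrefl)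

text \<open>Extend every codeword in all ways to a common length \<open>N\<close>. By
  prefix-freeness the sets of extensions are disjoint, and they live among \<open>2 ^ N\<close>
  words.\<close>

lemma kraft_inequality:
  fixes c :: "'w \<Rightarrow> bool list"
  assumes "finite F"
    and pf: "\<And>v w. v \<in> F \<Longrightarrow> w \<in> F \<Longrightarrow> prefix (c v) (c w) \<Longrightarrow> v = w"
  shows "(\<Sum>w\<in>F. (1/2) ^ length (c w)) \<le> (1::real)"
proof -
  have card_words: "card {t :: bool list. length t = n} = 2 ^ n" for n
    using card_lists_length_eq[of "UNIV :: bool set" n] by simp
  have finite_words: "finite {t :: bool list. length t = n}" for n
    using finite_lists_length_eq[of "UNIV :: bool set" n] by simp
  \<comment> \<open>Any common upper bound on the lengths would do; the sum also makes sense for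
    empty \<open>F\<close>.\<close>
  define N where "N = (\<Sum>w\<in>F. length (c w))"
  have N: "length (c w) \<le> N" if "w \<in> F" for w
    unfolding N_def using assms(1) that by (intro member_le_sum) auto
  define E where "E w = (@) (c w) ` {t. length t = N - length (c w)}" for w
  have E_card: "card (E w) = 2 ^ (N - length (c w))" for w
    unfolding E_def by (simp add: card_image inj_on_def card_words)
  have disj: "E v \<inter> E w = {}" if "v \<in> F" "w \<in> F" "v \<noteq> w" for v w
  proof (rule ccontr)
    assume "E v \<inter> E w \<noteq> {}"
    then obtain s t where "c v @ s = c w @ t" by (auto simp: E_def)
    then have "prefix (c v) (c w) \<or> prefix (c w) (c v)"
      by (metis prefixI prefix_same_cases)
    then show False using pf that by metis
  qed
  have "(\<Sum>w\<in>F. 2 ^ (N - length (c w))) = card (\<Union>w\<in>F. E w)"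
    by (subst card_UN_disjoint) (use assms(1) disj finite_words in \<open>auto simp: E_card intro: finite_imageI simp: E_def[THEN arg_cong[of _ _ finite]]\<close>)
  also have "\<dots> \<le> card {t :: bool list. length t = N}"
    by (rule card_mono[OF finite_words]) (use N in \<open>auto simp: E_def\<close>)
  finally have le: "(\<Sum>w\<in>F. 2 ^ (N - length (c w))) \<le> (2 ^ N :: nat)" by (simp add: card_words)
  have "(\<Sum>w\<in>F. (1/2::real) ^ length (c w)) = (\<Sum>w\<in>F. 2 ^ (N - length (c w)) / 2 ^ N)"
    using N by (intro sum.cong) (auto simp: field_simps simp flip: power_add)
  also have "\<dots> = real (\<Sum>w\<in>F. 2 ^ (N - length (c w))) / 2 ^ N"
    by (simp add: sum_divide_distrib)
  also have "\<dots> \<le> real (2 ^ N) / 2 ^ N"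
    using le by (intro divide_right_mono) (auto simp only: of_nat_le_iff zero_le_power zero_le_numeral)
  finally show ?thesis by simp
qed

lemma kraft_code_exists:
  fixes l :: "'w::linorder \<Rightarrow> nat"
  assumes kraft: "\<And>F. finite F \<Longrightarrow> F \<subseteq> S \<Longrightarrow> (\<Sum>w\<in>F. (1/2) ^ l w) \<le> (1::real)"
  obtains c :: "'w \<Rightarrow> bool list"
    where "\<And>w. length (c w) = l w"
      and "\<And>v w. v \<in> S \<Longrightarrow> w \<in> S \<Longrightarrow> prefix (c v) (c w) \<Longrightarrow> v = w"
proof -
  txt \<open>Order the symbols by length, ties broken by the order on \<^typ>\<open>'w\<close>, and let the codeword of
    \<open>w\<close> be the first \<open>l w\<close> binary digits of the sum of \<open>(1/2) ^ l v\<close> over all \<open>v\<close> before \<open>w\<close>.\<close>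
  define B where "B w = {v \<in> S. l v < l w \<or> l v = l w \<and> v < w}" for w
  define m :: "'w \<Rightarrow> nat" where "m w = (\<Sum>v\<in>B w. 2 ^ (l w - l v))" for w
  \<comment> \<open>Each \<open>v\<close> in \<open>B w\<close> has weight at least
    \<open>(1/2) ^ l w\<close>, so Kraft's inequality allows at most \<open>2 ^ l w\<close> of
    them.\<close>
  have fin: "finite (B w)" for w
  proof -
    have "finite F \<and> card F \<le> 2 ^ l w" if F: "finite F" "F \<subseteq> B w" for F
    proof -
      have "real (card F) * (1/2) ^ l w = (\<Sum>v\<in>F. (1/2) ^ l w)" by simp
      also have "\<dots> \<le> (\<Sum>v\<in>F. (1/2) ^ l v)"
        using F by (intro sum_mono power_decreasing) (auto simp: B_def)
      also have "\<dots> \<le> 1" using F by (intro kraft) (auto simp: B_def)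
      finally have "real (card F) \<le> 2 ^ l w" by (simp add: field_simps)
      then have "real (card F) \<le> real (2 ^ l w)" by simp
      then show ?thesis using F by (simp only: of_nat_le_iff)
    qed
    then show ?thesis using finite_if_finite_subsets_card_bdd[of "B w" "2 ^ l w"] by blast
  qed
  \<comment> \<open>Applying Kraft to \<open>B w\<close> together with \<open>w\<close> leaves room
    for \<open>w\<close>, so the sum over \<open>B w\<close> is strictly below 1 and
    \<open>m w\<close> fits into \<open>l w\<close> digits.\<close>
  have less: "m w < 2 ^ l w" if "w \<in> S" for w
  proof -
    have "(\<Sum>v\<in>insert w (B w). (1/2) ^ l v) \<le> (1::real)"
      using that fin by (intro kraft) (auto simp: B_def)
    moreover have "w \<notin> B w" by (simp add: B_def)
    ultimately have "(\<Sum>v\<in>B w. (1/2) ^ l v) < (1::real)"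
      using fin by (simp add: add.commute) (smt (verit) zero_less_power zero_less_divide_iff)
    moreover have "real (m w) = 2 ^ l w * (\<Sum>v\<in>B w. (1/2) ^ l v)"
      unfolding m_def sum_distrib_left of_nat_sum
      by (intro sum.cong) (auto simp: B_def power_diff field_simps)
    ultimately have "real (m w) < real (2 ^ l w)" by simp
    then show ?thesis by (simp only: of_nat_less_iff)
  qed
  \<comment> \<open>\<open>B v\<close> and \<open>v\<close> itself all lie in \<open>B w\<close>.
    Geometrically, the dyadic intervals belonging to the codewords of \<open>v\<close> and
    \<open>w\<close> do not overlap.\<close>
  have step: "(m v + 1) * 2 ^ (l w - l v) \<le> m w" if v: "v \<in> B w" for v w
  proof -
    have vB: "v \<notin> B v" by (simp add: B_def)
    have "(m v + 1) * 2 ^ (l w - l v) = (\<Sum>u\<in>insert v (B v). 2 ^ (l w - l u))"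
      using v fin vB
      by (auto simp: m_def sum_distrib_right B_def simp flip: power_add intro!: sum.cong)
    also have "\<dots> \<le> m w"
      unfolding m_def using v by (intro sum_mono2 fin) (auto simp: B_def)
    finally show ?thesis .
  qed
  \<comment> \<open>The most significant digit comes first, so that passing to a prefix is
    \<open>drop_bit\<close>.\<close>
  define c where "c w = map (\<lambda>i. bit (m w) (l w - Suc i)) [0..<l w]" for w
  have drop: "drop_bit (l w - l v) (m w) = m v" and le: "l v \<le> l w"
    if v: "v \<in> S" and w: "w \<in> S" and pf: "prefix (c v) (c w)" for v w
  proof -
    show le: "l v \<le> l w" using prefix_length_le[OF pf] by (simp add: c_def)
    show "drop_bit (l w - l v) (m w) = m v"
    proof (rule bit_eqI)
      fix n
      have high: "\<not> bit (m u) k" if "u \<in> S" "l u \<le> k" for u k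
        proof -
          have "m u < 2 ^ k"
            using less[OF that(1)] by (rule less_le_trans) (use that(2) in simp)
          then show ?thesis by (simp add: bit_iff_odd)
        qed
      show "bit (drop_bit (l w - l v) (m w)) n \<longleftrightarrow> bit (m v) n"
      proof (cases "n < l v")
        case True
        obtain t where "c w = c v @ t" using pf by (auto simp: prefix_def)
        moreover have i: "l v - Suc n < l v" "l v - Suc n < l w" "l v - Suc (l v - Suc n) = n"
            "l w - Suc (l v - Suc n) = l w - l v + n"
          using True le by auto
        ultimately have "c w ! (l v - Suc n) = c v ! (l v - Suc n)"
          by (simp add: nth_append c_def)
        then have "bit (m w) (l w - Suc (l v - Suc n)) = bit (m v) (l v - Suc (l v - Suc n))"
          unfolding c_def using i(1,2) by (simp del: diff_Suc_Suc)
        then show ?thesis unfolding i(3,4) by (simp add: bit_drop_bit_eq)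
      next
        case False
        with le show ?thesis using high[OF v, of n] high[OF w, of "l w - l v + n"]
          by (simp add: bit_drop_bit_eq)
      qed
    qed
  qed
  show ?thesis
  proof (rule that[of c])
    show "length (c w) = l w" for w by (simp add: c_def)
    fix v w assume v: "v \<in> S" and w: "w \<in> S" and pf: "prefix (c v) (c w)"
    \<comment> \<open>By \<open>step\<close>, the leading digits of \<open>m u'\<close> form a
      number of at least \<open>m u + 1\<close> when \<open>u\<close> precedes
      \<open>u'\<close>.\<close>
    have *: "u \<notin> B u'" if "drop_bit (l u' - l u) (m u') = m u" for u u'
    proof
      assume "u \<in> B u'"
      then have "m u + 1 \<le> m u' div 2 ^ (l u' - l u)"
        using step by (simp add: less_eq_div_iff_mult_less_eq)
      with that show False by (simp add: drop_bit_eq_div)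
    qed
    from drop[OF v w pf] have "v \<notin> B w" by (rule *)
    \<comment> \<open>As \<open>l v \<le> l w\<close>, \<open>w\<close> can precede \<open>v\<close>
      only at equal length; then \<open>drop\<close> says \<open>m w = m v\<close>, which is
      symmetric.\<close>
    moreover have "w \<notin> B v" if "l v = l w" using drop[OF v w pf] that by (intro *) simp
    ultimately show "v = w" using le[OF v w pf] v w by (force simp: B_def)
  qed
qed

section \<open>Source coding: entropy against optimal code rate\<close>

text \<open>Writes a Kraft sum over the support as an expectation under \<open>P\<close>, so that it
  can be compared pointwise with entropy and code length.\<close>

lemma nn_integral_divide_pmf:
  assumes "\<And>w. 0 \<le> f w"
  shows "(\<integral>\<^sup>+w. ennreal (f w / pmf P w) \<partial>measure_pmf P)
    = (\<integral>\<^sup>+w. ennreal (f w) \<partial>count_space (set_pmf P))"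
  unfolding nn_integral_measure_pmf
  by (subst (2) nn_integral_count_space_indicator)
     (auto intro!: nn_integral_cong simp: set_pmf_iff assms indicator_def simp flip: ennreal_mult)

text \<open>Gibbs' inequality: take expectations in \<open>ln t \<le> t - 1\<close> with
  \<open>t\<close> the ratio of \<open>(1/2) ^ length (c w)\<close> to \<open>pmf P w\<close>, and
  bound the mean of \<open>t\<close> by Kraft.\<close>

lemma entropy_le_expected_length:
  fixes P :: "nat pmf"
  assumes "prefix_free_code P c"
  shows "shannon_entropy P \<le> expected_length P c"
proof -
  have "(\<integral>\<^sup>+w. ennreal ((1/2) ^ length (c w)) \<partial>count_space (set_pmf P)) \<le> 1"
  proof -
    have "(\<integral>\<^sup>+w. ennreal ((1/2) ^ length (c w)) \<partial>count_space (set_pmf P))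
      = (\<Sum>w. ennreal ((1/2) ^ length (c w)) * indicator (set_pmf P) w)"
      by (simp add: nn_integral_count_space_indicator nn_integral_count_space_nat)
    also have "\<dots> \<le> 1"
    proof (rule suminf_le_const)
      fix n
      have "(\<Sum>w<n. ennreal ((1/2) ^ length (c w)) * indicator (set_pmf P) w)
        = (\<Sum>w\<in>{..<n} \<inter> set_pmf P. ennreal ((1/2) ^ length (c w)))"
        by (simp add: sum.inter_restrict indicator_def if_distrib cong: if_cong)
      also have "\<dots> = ennreal (\<Sum>w\<in>{..<n} \<inter> set_pmf P. (1/2) ^ length (c w))"
        by (rule sum_ennreal) simp
      also have "\<dots> \<le> ennreal 1"
        using assms by (intro ennreal_leI kraft_inequality) (auto simp: prefix_free_code_iff)
      finally show "(\<Sum>w<n. ennreal ((1/2) ^ length (c w)) * indicator (set_pmf P) w) \<le> 1"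
        by simp
    qed simp
    finally show ?thesis .
  qed
  then have kraft: "(\<integral>\<^sup>+w. ennreal ((1/2) ^ length (c w) / pmf P w) \<partial>measure_pmf P) \<le> 1"
    by (simp add: nn_integral_divide_pmf)
  \<comment> \<open>The constant stays on the left because subtraction in \<open>ennreal\<close>
    truncates; being finite, it cancels at the end.\<close>
  have "ennreal (1 / ln 2) + shannon_entropy P
    = (\<integral>\<^sup>+w. ennreal (1 / ln 2) + ennreal (log 2 (1 / pmf P w)) \<partial>measure_pmf P)"
    unfolding shannon_entropy_def by (subst nn_integral_add) auto
  also have "\<dots> \<le> (\<integral>\<^sup>+w. ennreal (1 / ln 2) * ennreal ((1/2) ^ length (c w) / pmf P w)
      + of_nat (length (c w)) \<partial>measure_pmf P)"
  proof (rule nn_integral_mono_AE, unfold AE_measure_pmf_iff, rule ballI)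
    fix w assume w: "w \<in> set_pmf P"
    let ?p = "pmf P w" and ?n = "length (c w)"
    have p: "0 < ?p" "?p \<le> 1" using w by (auto simp: pmf_positive pmf_le_1)
    have "ln ((1/2) ^ ?n / ?p) \<le> (1/2) ^ ?n / ?p - 1"
      using p by (intro ln_le_minus_one) simp
    then have "ln (1 / ?p) + 1 \<le> (1/2) ^ ?n / ?p + ?n * ln 2"
      using p by (simp add: ln_div ln_realpow ln_mult)
    then have "1 / ln 2 + log 2 (1 / ?p) \<le> 1 / ln 2 * ((1/2) ^ ?n / ?p) + ?n"
      by (simp add: log_def field_simps)
    then have "ennreal (1 / ln 2 + log 2 (1 / ?p)) \<le> ennreal (1 / ln 2 * ((1/2) ^ ?n / ?p) + ?n)"
      by (rule ennreal_leI)
    moreover have "ennreal (1 / ln 2 + log 2 (1 / ?p)) = ennreal (1 / ln 2) + ennreal (log 2 (1 / ?p))"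
      using p by (intro ennreal_plus) auto
    moreover have "ennreal (1 / ln 2 * ((1/2) ^ ?n / ?p) + ?n)
      = ennreal (1 / ln 2) * ennreal ((1/2) ^ ?n / ?p) + of_nat ?n"
      proof -
      have "0 \<le> 1 / ln 2 * ((1/2) ^ ?n / ?p)" "0 \<le> (1/2) ^ ?n / ?p" "0 \<le> 1 / ln (2::real)"
        using p by auto
      then show ?thesis
        by (simp only: ennreal_plus ennreal_mult ennreal_of_nat_eq_real_of_nat of_nat_0_le_iff)
    qed
    ultimately show "ennreal (1 / ln 2) + ennreal (log 2 (1 / ?p))
      \<le> ennreal (1 / ln 2) * ennreal ((1/2) ^ ?n / ?p) + of_nat ?n"
      by (simp only:)
  qed
  also have "\<dots> = ennreal (1 / ln 2) *
      (\<integral>\<^sup>+w. ennreal ((1/2) ^ length (c w) / pmf P w) \<partial>measure_pmf P) + expected_length P c"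
    unfolding expected_length_def by (subst nn_integral_add) (auto simp: nn_integral_cmult)
  also have "\<dots> \<le> ennreal (1 / ln 2) * 1 + expected_length P c"
    using kraft by (intro add_right_mono mult_left_mono) auto
  finally show ?thesis by (simp add: ennreal_add_left_cancel_le)
qed

lemma entropy_le_code_rate: "shannon_entropy P \<le> code_rate P" for P :: "nat pmf"
  unfolding code_rate_def by (intro INF_greatest) (simp add: entropy_le_expected_length)

text \<open>By the converse of Kraft's inequality, upper bounds on the rate need only a choice of
  lengths, not of codewords.\<close>

lemma code_rate_le_of_kraft:
  fixes P :: "'w::linorder pmf"
  assumes "(\<integral>\<^sup>+w. ennreal ((1/2) ^ l w / pmf P w) \<partial>measure_pmf P) \<le> 1"
  shows "code_rate P \<le> (\<integral>\<^sup>+w. of_nat (l w) \<partial>measure_pmf P)"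
proof -
  have "(\<Sum>w\<in>F. (1/2) ^ l w) \<le> (1::real)" if F: "finite F" "F \<subseteq> set_pmf P" for F
  proof -
    have "ennreal (\<Sum>w\<in>F. (1/2) ^ l w) = (\<integral>\<^sup>+w. ennreal ((1/2) ^ l w) \<partial>count_space F)"
      using F by (simp add: nn_integral_count_space_finite sum_ennreal)
    also have "\<dots> \<le> (\<integral>\<^sup>+w. ennreal ((1/2) ^ l w) \<partial>count_space (set_pmf P))"
      using F by (auto simp: nn_integral_count_space_indicator indicator_def intro!: nn_integral_mono)
    also have "\<dots> \<le> ennreal 1" using assms by (simp add: nn_integral_divide_pmf)
    finally show ?thesis by simp
  qed
  then obtain c :: "'w \<Rightarrow> bool list" where c: "\<And>w. length (c w) = l w"
      "\<And>v w. v \<in> set_pmf P \<Longrightarrow> w \<in> set_pmf P \<Longrightarrow> prefix (c v) (c w) \<Longrightarrow> v = w"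
    by (rule kraft_code_exists) blast+
  then have "prefix_free_code P c" by (auto simp: prefix_free_code_iff)
  then have "code_rate P \<le> expected_length P c" unfolding code_rate_def by (intro INF_lower) simp
  with c(1) show ?thesis by (simp add: expected_length_def)
qed

text \<open>A convex function lies below its chord, here between \<open>r = 0\<close> and
  \<open>r = 1\<close>.\<close>

lemma two_powr_minus_le:
  assumes "0 \<le> r" "r \<le> 1"
  shows "2 powr (- r) \<le> 1 - r / (2::real)"
proof -
  have "exp ((1 - r) *\<^sub>R 0 + r *\<^sub>R (- ln 2)) \<le> (1 - r) * exp 0 + r * exp (- ln 2 :: real)"
    using assms by (intro convex_onD[OF exp_convex]) auto
  then show ?thesis by (simp add: powr_def exp_minus algebra_simps)
qed

text \<open>With Shannon's lengths \<open>l\<close>, \<open>r\<close> is the pointwise redundancy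
  and \<open>R\<close> its mean. If \<open>R \<le> 1 - d / 2\<close>, these lengths suffice.
  Otherwise dropping one bit off \<open>S\<close> keeps the Kraft sum at most
  \<open>2 - R - measure_pmf.prob P S / 2\<close>, which is below 1, and saves \<open>d\<close> bits
  on average.\<close>

lemma code_rate_add_le_entropy:
  fixes P :: "nat pmf"
  assumes d: "0 < d" and S: "d \<le> measure_pmf.prob P S" "measure_pmf.prob P S \<le> 1 - d"
  shows "code_rate P + ennreal (d / 2) \<le> shannon_entropy P + 1"
proof -
  define lg where "lg w = log 2 (1 / pmf P w)" for w
  define l where "l w = nat \<lceil>lg w\<rceil>" for w
  define r where "r w = real (l w) - lg w" for w
  have p: "0 < pmf P w" "pmf P w \<le> 1" if "w \<in> set_pmf P" for w
    using that by (auto simp: pmf_positive pmf_le_1)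
  have lg0: "0 \<le> lg w" if "w \<in> set_pmf P" for w using p[OF that] by (simp add: lg_def)
  have r: "0 \<le> r w" "r w \<le> 1" if "w \<in> set_pmf P" for w
    using lg0[OF that] by (simp_all add: r_def l_def) linarith+
  have K_eq: "(1/2) ^ l w / pmf P w = 2 powr (- r w)" if "w \<in> set_pmf P" for w
    using p[OF that]
    by (simp add: r_def lg_def powr_diff powr_minus powr_realpow log_divide power_one_over field_simps)
  have K: "1 / 2 \<le> (1/2) ^ l w / pmf P w" "(1/2) ^ l w / pmf P w \<le> 1 - r w / 2"
    if "w \<in> set_pmf P" for w
  proof -
    have "2 powr (-1) \<le> (2::real) powr (- r w)" using r[OF that] by (intro powr_mono) auto
    then show "1 / 2 \<le> (1/2) ^ l w / pmf P w" by (simp add: K_eq[OF that] powr_minus)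
    show "(1/2) ^ l w / pmf P w \<le> 1 - r w / 2"
      unfolding K_eq[OF that] using r[OF that] by (rule two_powr_minus_le)
  qed
  define R where "R = measure_pmf.expectation P r"
  have int: "integrable P r"
    by (rule measure_pmf.integrable_const_bound[where B = 1]) (auto simp: AE_measure_pmf_iff r)
  have R1: "R \<le> 1"
    unfolding R_def by (intro measure_pmf.integral_le_const int) (auto simp: AE_measure_pmf_iff r)
  have R0: "0 \<le> R"
    unfolding R_def by (intro integral_nonneg_AE) (auto simp: AE_measure_pmf_iff r)
  have rate: "(\<integral>\<^sup>+w. of_nat (l w) \<partial>measure_pmf P) = shannon_entropy P + ennreal R"
  proof -
    have "(\<integral>\<^sup>+w. of_nat (l w) \<partial>measure_pmf P)
      = (\<integral>\<^sup>+w. ennreal (lg w) + ennreal (r w) \<partial>measure_pmf P)"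
    proof (intro nn_integral_cong_AE, unfold AE_measure_pmf_iff, rule ballI)
      fix w assume w: "w \<in> set_pmf P"
      have "ennreal (lg w) + ennreal (r w) = ennreal (lg w + r w)"
        using lg0[OF w] r(1)[OF w] by (rule ennreal_plus[symmetric])
      then show "of_nat (l w) = ennreal (lg w) + ennreal (r w)"
        by (simp add: r_def ennreal_of_nat_eq_real_of_nat)
    qed
    also have "\<dots> = (\<integral>\<^sup>+w. ennreal (lg w) \<partial>measure_pmf P) + (\<integral>\<^sup>+w. ennreal (r w) \<partial>measure_pmf P)"
      by (rule nn_integral_add) auto
    also have "(\<integral>\<^sup>+w. ennreal (r w) \<partial>measure_pmf P) = ennreal R"
      unfolding R_def by (rule nn_integral_eq_integral[OF int]) (auto simp: AE_measure_pmf_iff r)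
    finally show ?thesis by (simp add: shannon_entropy_def lg_def)
  qed
  show ?thesis
  proof (cases "R \<le> 1 - d / 2")
    case True
    have "(\<integral>\<^sup>+w. ennreal ((1/2) ^ l w / pmf P w) \<partial>measure_pmf P) \<le> (\<integral>\<^sup>+w. 1 \<partial>measure_pmf P)"
      by (rule nn_integral_mono_AE) (use K(2) r in \<open>fastforce simp: AE_measure_pmf_iff\<close>)
    then have "code_rate P \<le> shannon_entropy P + ennreal R"
      using code_rate_le_of_kraft[of P l] rate by simp
    then have "code_rate P + ennreal (d / 2) \<le> shannon_entropy P + (ennreal R + ennreal (d / 2))"
      by (simp add: add.assoc[symmetric] add_right_mono)
    also have "ennreal R + ennreal (d / 2) \<le> ennreal 1"
      using True R0 d by (simp flip: ennreal_plus)
    finally show ?thesis by (simp add: add_left_mono)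
  next
    case False
    define l' where "l' w = (if w \<in> S then l w else l w - 1)" for w
    \<comment> \<open>There is a bit to drop: since \<open>S\<close> has positive probability, no
      symbol outside it has probability 1.\<close>
    have l1: "1 \<le> l w" if w: "w \<in> set_pmf P" "w \<notin> S" for w
    proof -
      have "measure_pmf.prob P S + pmf P w = measure_pmf.prob P (S \<union> {w})"
        using w by (subst measure_pmf.finite_measure_Union) (auto simp: measure_pmf_single)
      also have "\<dots> \<le> 1" by simp
      finally have "pmf P w < 1" using S d by simp
      then have "0 < lg w" using p[OF w(1)] by (simp add: lg_def)
      then show ?thesis by (simp add: l_def) linarith
    qed
    \<comment> \<open>Off \<open>S\<close> the bound \<open>1 - r w / 2\<close> is doubled; on
      \<open>S\<close> it is at most \<open>3 / 2 - r w\<close> because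
      \<open>r w \<le> 1\<close>.\<close>
    have bound: "(1/2) ^ l' w / pmf P w \<le> 2 - r w - indicator S w / 2" if w: "w \<in> set_pmf P" for w
    proof (cases "w \<in> S")
      case True
      with K(2)[OF w] r[OF w] show ?thesis by (simp add: l'_def)
    next
      case False
      then have "(1/2) ^ l' w = 2 * (1/2::real) ^ l w"
        using l1[OF w] by (cases "l w") (auto simp: l'_def)
      with False K(2)[OF w] show ?thesis by (simp add: field_simps)
    qed
    have intS: "integrable P (\<lambda>w. indicat_real S w / 2)"
      by (intro integrable_divide_zero integrable_real_indicator)
         (auto simp: measure_pmf.emeasure_eq_measure)
    have "(\<integral>\<^sup>+w. ennreal ((1/2) ^ l' w / pmf P w) \<partial>measure_pmf P)
      \<le> (\<integral>\<^sup>+w. ennreal (2 - r w - indicator S w / 2) \<partial>measure_pmf P)"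
      by (rule nn_integral_mono_AE) (auto simp: AE_measure_pmf_iff intro!: ennreal_leI bound)
    also have "\<dots> = ennreal (LINT w|P. 2 - r w - indicator S w / 2)"
    proof (rule nn_integral_eq_integral)
      show "integrable P (\<lambda>w. 2 - r w - indicator S w / 2)"
        using int intS by simp
      show "AE w in P. 0 \<le> 2 - r w - indicator S w / 2"
        using r by (fastforce simp: AE_measure_pmf_iff indicator_def)
    qed
    also have "(LINT w|P. 2 - r w - indicator S w / 2) = 2 - R - measure_pmf.prob P S / 2"
      using int intS by (simp add: R_def)
    also have "ennreal \<dots> \<le> ennreal 1" using False S by (intro ennreal_leI) simp
    finally have "code_rate P \<le> (\<integral>\<^sup>+w. of_nat (l' w) \<partial>measure_pmf P)"
      by (intro code_rate_le_of_kraft) simp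
    moreover have "ennreal d \<le> emeasure P (- S)"
      using S measure_pmf.prob_compl[of S P]
      by (simp add: measure_pmf.emeasure_eq_measure Compl_eq_Diff_UNIV ennreal_leI)
    ultimately have "code_rate P + ennreal d
      \<le> (\<integral>\<^sup>+w. of_nat (l' w) \<partial>measure_pmf P) + (\<integral>\<^sup>+w. indicator (- S) w \<partial>measure_pmf P)"
      by (simp add: add_mono)
    also have "\<dots> = (\<integral>\<^sup>+w. of_nat (l' w) + indicator (- S) w \<partial>measure_pmf P)"
      by (rule nn_integral_add[symmetric]) auto
    also have "\<dots> = (\<integral>\<^sup>+w. of_nat (l w) \<partial>measure_pmf P)"
    proof (intro nn_integral_cong_AE, unfold AE_measure_pmf_iff, rule ballI)
      fix w assume "w \<in> set_pmf P"
      then show "of_nat (l' w) + indicator (- S) w = (of_nat (l w) :: ennreal)"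
        using l1[of w] by (cases "w \<in> S"; cases "l w") (auto simp: l'_def)
    qed
    also have "\<dots> \<le> shannon_entropy P + ennreal 1"
      unfolding rate using R1 by (intro add_left_mono ennreal_leI)
    finally have "code_rate P + ennreal d \<le> shannon_entropy P + 1" by simp
    moreover have "ennreal (d / 2) \<le> ennreal d" using d by (intro ennreal_leI) simp
    ultimately show ?thesis by (meson add_left_mono order_trans)
  qed
qed

section \<open>Simulation codes and Markov chains\<close>

text \<open>The joint law \<open>q\<close> of \<open>W\<close> and the decoder outputs is a Markov
  chain, since conditioning on \<open>w\<close> returns the product of the two decoders. The
  alphabet of \<open>W\<close> is arbitrary so that \<open>W = (X, Y)\<close> is covered.\<close>

lemma common_entropy_le_of_exactly_generated:
  fixes P :: "'w pmf" and p :: "('a \<times> 'b) pmf"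
  assumes "exactly_generated p P dX dY"
  shows "common_entropy p \<le> shannon_entropy P"
proof -
  define q where "q = bind_pmf P (\<lambda>w. map_pmf (\<lambda>(x, y). (x, w, y)) (pair_pmf (dX w) (dY w)))"
  have W: "map_pmf (\<lambda>(x, w, y). w) q = P"
    by (simp add: q_def map_bind_pmf map_pmf_comp case_prod_unfold map_pmf_const bind_return_pmf')
  have p: "simulated_pair P dX dY = p"
    using assms by (auto simp: exactly_generated_def intro!: pmf_eqI)
  have marg: "map_pmf (\<lambda>(x, w, y). (x, y)) q = p"
    unfolding p[symmetric]
    by (simp add: q_def simulated_pair_def map_bind_pmf map_pmf_comp case_prod_unfold)
  have pmf_q: "pmf q (x, w, y) = pmf P w * pmf (pair_pmf (dX w) (dY w)) (x, y)" for x w y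
  proof -
    have "pmf (map_pmf (\<lambda>(x, y). (x, v, y)) (pair_pmf (dX v) (dY v))) (x, w, y)
      = (if v = w then pmf (pair_pmf (dX w) (dY w)) (x, y) else 0)" for v
    proof (cases "v = w")
      case True
      have "inj (\<lambda>(x, y). (x, w, y))" by (auto simp: inj_def)
      from pmf_map_inj'[OF this, of _ "(x, y)"] True show ?thesis by simp
    qed (auto simp: pmf_eq_0_set_pmf)
    then show ?thesis
      unfolding q_def pmf_bind by (subst integral_measure_pmf_real[of "{w}"]) (auto split: if_splits)
  qed
  have "markov_chain q"
    unfolding markov_chain_def Let_def
  proof
    fix w assume "w \<in> set_pmf (map_pmf (\<lambda>(x, w, y). w) q)"
    then have w: "w \<in> set_pmf P" by (simp only: W)
    let ?B = "{(x, w', y) | x w' y. w' = w}"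
    have B: "?B = (\<lambda>(x, w, y). w) -` {w}" by auto
    have m: "measure_pmf.prob q ?B = pmf P w" unfolding B by (simp only: pmf_map[symmetric] W)
    with w have ne: "set_pmf q \<inter> ?B \<noteq> {}"
      using measure_Int_set_pmf[of q ?B] by (auto simp: set_pmf_iff Int_commute)
    have "cond_pmf q ?B = map_pmf (\<lambda>(x, y). (x, w, y)) (pair_pmf (dX w) (dY w))"
    proof (rule pmf_eqI)
      fix z :: "'a \<times> 'w \<times> 'b"
      obtain x v y where z: "z = (x, v, y)" by (cases z)
      show "pmf (cond_pmf q ?B) z = pmf (map_pmf (\<lambda>(x, y). (x, w, y)) (pair_pmf (dX w) (dY w))) z"
      proof (cases "v = w")
        case True
        have "inj (\<lambda>(x, y). (x, w, y))" by (auto simp: inj_def)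
        from pmf_map_inj'[OF this, of _ "(x, y)"] True w show ?thesis
          unfolding z pmf_cond[OF ne] m by (simp add: pmf_q set_pmf_iff)
      next
        case False
        then have "z \<notin> ?B" "z \<notin> set_pmf (map_pmf (\<lambda>(x, y). (x, w, y)) (pair_pmf (dX w) (dY w)))"
          by (auto simp: z)
        then show ?thesis unfolding pmf_cond[OF ne] by (simp only: set_pmf_iff not_not if_False)
      qed
    qed
    then show "map_pmf (\<lambda>(x, w, y). (x, y)) (cond_pmf q ?B) =
      pair_pmf (map_pmf (\<lambda>(x, w, y). x) (cond_pmf q ?B)) (map_pmf (\<lambda>(x, w, y). y) (cond_pmf q ?B))"
      by (simp add: map_pmf_comp case_prod_unfold map_fst_pair_pmf map_snd_pair_pmf)
  qed
  from common_entropy_le[OF marg this] show ?thesis by (simp only: W)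
qed

text \<open>The decoders are the two marginals of \<open>q\<close> conditioned on \<open>W\<close>;
  averaging the conditional laws over \<open>W\<close> restores \<open>q\<close>.\<close>

lemma exactly_generated_of_markov_chain:
  assumes marg: "map_pmf (\<lambda>(x, w, y). (x, y)) q = p" and "markov_chain q"
  shows "\<exists>dX dY. exactly_generated p (map_pmf (\<lambda>(x, w, y). w) q) dX dY"
proof -
  let ?P = "map_pmf (\<lambda>(x, w, y). w) q"
  define r where "r w = cond_pmf q {(x, w', y) | x w' y. w' = w}" for w
  have "bind_pmf ?P r = q"
  proof -
    have R: "{(x, w', y) | x w' y. w' = w} = {z. fst (snd z) = w}" for w by auto
    show ?thesis
      unfolding r_def R
    proof (rule bind_cond_pmf_cancel[where R = "\<lambda>w z. fst (snd z) = w"])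
      fix w z assume "w \<in> set_pmf ?P" "z \<in> set_pmf q" and z: "fst (snd z) = w"
      have "measure_pmf.prob q {y. fst (snd y) = w} = pmf ?P w"
        unfolding pmf_map by (rule arg_cong[where f = "measure_pmf.prob q"]) auto
      also have "\<dots> = measure_pmf.prob ?P {w}" by (simp add: measure_pmf_single)
      also have "{w} = {x. fst (snd z) = x}" using z by auto
      finally show "measure_pmf.prob q {y. fst (snd y) = w} = measure_pmf.prob ?P {x. fst (snd z) = x}" .
    qed (fastforce simp: case_prod_unfold)+
  qed
  then have "p = bind_pmf ?P (\<lambda>w. map_pmf (\<lambda>(x, w, y). (x, y)) (r w))"
    using marg by (simp add: map_bind_pmf[symmetric])
  also have "\<dots> = bind_pmf ?P (\<lambda>w. pair_pmf (map_pmf (\<lambda>(x, w, y). x) (r w)) (map_pmf (\<lambda>(x, w, y). y) (r w)))"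
    using assms(2) by (intro bind_pmf_cong refl) (simp only: markov_chain_def Let_def r_def)
  also have "\<dots> = simulated_pair ?P (\<lambda>w. map_pmf (\<lambda>(x, w, y). x) (r w)) (\<lambda>w. map_pmf (\<lambda>(x, w, y). y) (r w))"
    by (simp only: simulated_pair_def)
  finally show ?thesis unfolding exactly_generated_def by (intro exI allI) simp
qed

section \<open>Dominant atoms and closeness to a product\<close>

text \<open>The difference \<open>g w - g v\<close> vanishes at \<open>w = v\<close> and is at most
  1 in absolute value elsewhere.\<close>

lemma expectation_minus_at_atom_le:
  assumes "\<And>w. 0 \<le> g w" "\<And>w. g w \<le> (1::real)"
  shows "\<bar>measure_pmf.expectation P g - g v\<bar> \<le> 1 - pmf P v"
proof -
  have int: "integrable P g"
    by (rule measure_pmf.integrable_const_bound[where B = 1]) (auto simp: assms)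
  have "measure_pmf.expectation P g - g v = (LINT w|P. g w - g v)" using int by simp
  also have "\<bar>\<dots>\<bar> \<le> (LINT w|P. \<bar>g w - g v\<bar>)" by (rule integral_abs_bound)
  also have "\<dots> \<le> (LINT w|P. 1 - indicator {v} w)"
  proof (rule integral_mono)
    show "\<bar>g w - g v\<bar> \<le> 1 - indicator {v} w" for w
      using assms(1)[of w] assms(1)[of v] assms(2)[of w] assms(2)[of v]
      by (cases "w = v") (auto simp: abs_le_iff)
  qed (use int in \<open>auto intro!: integrable_real_indicator simp: measure_pmf.emeasure_eq_measure\<close>)
  also have "\<dots> = 1 - pmf P v"
    by (subst Bochner_Integration.integral_diff)
       (auto intro!: integrable_real_indicator simp: measure_pmf.emeasure_eq_measure measure_pmf_single)
  finally show ?thesis .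
qed

text \<open>Given \<open>W = v\<close> the outputs are independent. Replacing the joint pmf and both
  marginals by their values given \<open>v\<close> costs at most \<open>1 - pmf P v\<close>
  each.\<close>

lemma simulated_pair_near_product:
  fixes p :: "('a \<times> 'b) pmf"
  assumes gen: "exactly_generated p P dX dY"
  shows "\<bar>pmf p (x, y) - pmf (map_pmf fst p) x * pmf (map_pmf snd p) y\<bar> \<le> 3 * (1 - pmf P v)"
proof -
  define e where "e = 1 - pmf P v"
  have p: "p = simulated_pair P dX dY"
    using gen by (auto simp: exactly_generated_def intro!: pmf_eqI)
  let ?a = "\<lambda>w. pmf (dX w) x" and ?b = "\<lambda>w. pmf (dY w) y"
  let ?p = "pmf p (x, y)" and ?pX = "pmf (map_pmf fst p) x" and ?pY = "pmf (map_pmf snd p) y"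
  have "?p = measure_pmf.expectation P (\<lambda>w. ?a w * ?b w)"
    by (simp add: p simulated_pair_def pmf_bind pmf_pair)
  then have 1: "\<bar>?p - ?a v * ?b v\<bar> \<le> e"
    unfolding e_def by (simp only:) (rule expectation_minus_at_atom_le; simp add: pmf_le_1 mult_le_one)
  have "?pX = measure_pmf.expectation P ?a"
    by (simp add: p simulated_pair_def map_bind_pmf map_fst_pair_pmf pmf_bind)
  then have 2: "\<bar>?pX - ?a v\<bar> \<le> e"
    unfolding e_def by (simp only:) (rule expectation_minus_at_atom_le; simp add: pmf_le_1)
  have "?pY = measure_pmf.expectation P ?b"
    by (simp add: p simulated_pair_def map_bind_pmf map_snd_pair_pmf pmf_bind)
  then have 3: "\<bar>?pY - ?b v\<bar> \<le> e"
    unfolding e_def by (simp only:) (rule expectation_minus_at_atom_le; simp add: pmf_le_1)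
  have "?p - ?pX * ?pY = (?p - ?a v * ?b v) - ?pX * (?pY - ?b v) - ?b v * (?pX - ?a v)"
    by (simp add: algebra_simps)
  moreover have "\<bar>?pX * (?pY - ?b v)\<bar> \<le> 1 * e"
    unfolding abs_mult using 3 by (intro mult_mono) (auto simp: pmf_le_1)
  moreover have "\<bar>?b v * (?pX - ?a v)\<bar> \<le> 1 * e"
    unfolding abs_mult using 2 by (intro mult_mono) (auto simp: pmf_le_1)
  ultimately show ?thesis using 1 unfolding e_def[symmetric] by linarith
qed

text \<open>Take the first initial segment whose mass reaches \<open>d\<close>. If that mass exceeds
  \<open>1 - d\<close>, its last point carries the jump from below \<open>d\<close>.\<close>

lemma balanced_set_or_large_atom:
  fixes P :: "nat pmf"
  assumes "0 < d" "d < 1"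
  obtains S where "d \<le> measure_pmf.prob P S" "measure_pmf.prob P S \<le> 1 - d"
  | v where "1 - 2 * d < pmf P v"
proof -
  let ?m = "\<lambda>n. measure_pmf.prob P {..<n}"
  have "?m \<longlonglongrightarrow> measure_pmf.prob P (\<Union>n. {..<n})"
    by (rule measure_pmf.finite_Lim_measure_incseq) (auto simp: incseq_def)
  moreover have "(\<Union>n. {..<n::nat}) = UNIV" by auto
  ultimately have "eventually (\<lambda>n. d < ?m n) sequentially"
    using assms(2) by (intro order_tendstoD) auto
  then obtain N where "d < ?m N" by (auto simp: eventually_sequentially)
  define n where "n = (LEAST n. d \<le> ?m n)"
  have n: "d \<le> ?m n" unfolding n_def by (rule LeastI[of "\<lambda>n. d \<le> ?m n" N]) (use \<open>d < ?m N\<close> in simp)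
  \<comment> \<open>The empty segment has mass 0, which is below \<open>d\<close>.\<close>
  with assms(1) obtain k where k: "n = Suc k" by (cases n) auto
  have "?m k < d" using not_less_Least[of k "\<lambda>n. d \<le> ?m n"] k unfolding n_def by simp
  moreover have "?m n = ?m k + pmf P k"
    by (simp add: k lessThan_Suc measure_measure_pmf_finite)
  ultimately have "1 - 2 * d < pmf P k" if "\<not> ?m n \<le> 1 - d" using that by linarith
  with n show ?thesis using that by blast
qed

section \<open>Finiteness, the product case and the two bounds\<close>

text \<open>The choice \<open>W = (X, Y)\<close> has finite entropy. Finiteness is what later makes
  the upper bound strict.\<close>

lemma common_entropy_finite:
  assumes "finite (set_pmf p)"
  shows "common_entropy p < \<top>"
proof -
  have "exactly_generated p p (\<lambda>w. return_pmf (fst w)) (\<lambda>w. return_pmf (snd w))"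
    by (simp add: exactly_generated_def simulated_pair_def pair_return_pmf1 map_return_pmf bind_return_pmf')
  then have "common_entropy p \<le> shannon_entropy p" by (rule common_entropy_le_of_exactly_generated)
  also have "\<dots> < \<top>"
    unfolding shannon_entropy_def
    by (subst nn_integral_measure_pmf_finite[OF assms])
       (auto simp: assms ennreal_mult_less_top)
  finally show ?thesis .
qed

text \<open>A constant \<open>W\<close> gets the empty codeword, and the decoders sample
  independently.\<close>

lemma exact_common_information_pair_pmf: "exact_common_information (pair_pmf a b) = 0"
proof -
  have "exactly_generated (pair_pmf a b) (return_pmf (0::nat)) (\<lambda>_. a) (\<lambda>_. b)"
    by (simp add: exactly_generated_def simulated_pair_def)
  then have "exact_common_information (pair_pmf a b) \<le> code_rate (return_pmf (0::nat))"
    unfolding exact_common_information_def by (intro INF_lower) auto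
  also have "\<dots> \<le> expected_length (return_pmf (0::nat)) (\<lambda>_. [])"
    unfolding code_rate_def by (intro INF_lower) (simp add: prefix_free_code_def)
  also have "\<dots> = 0" by (simp add: expected_length_def)
  finally show ?thesis by simp
qed

lemma common_entropy_le_exact_common_information:
  "common_entropy p \<le> exact_common_information p"
  unfolding exact_common_information_def
proof (rule INF_greatest)
  fix P :: "nat pmf" assume "P \<in> {P. \<exists>dX dY. exactly_generated p P dX dY}"
  then have "common_entropy p \<le> shannon_entropy P"
    by (auto intro: common_entropy_le_of_exactly_generated)
  also have "\<dots> \<le> code_rate P" by (rule entropy_le_code_rate)
  finally show "common_entropy p \<le> code_rate P" .
qed

text \<open>The gap \<open>e\<close> depends on \<open>p\<close> alone, so it survives the infimum
  over \<open>W\<close>.\<close>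

lemma exact_common_information_add_le:
  assumes "p \<noteq> pair_pmf (map_pmf fst p) (map_pmf snd p)"
  obtains e :: real where "0 < e" "exact_common_information p + ennreal e \<le> common_entropy p + 1"
proof -
  obtain x y where xy: "pmf p (x, y) \<noteq> pmf (map_pmf fst p) x * pmf (map_pmf snd p) y"
    using assms by (metis pmf_eqI pmf_pair surj_pair)
  define \<epsilon> where "\<epsilon> = \<bar>pmf p (x, y) - pmf (map_pmf fst p) x * pmf (map_pmf snd p) y\<bar>"
  \<comment> \<open>An atom above \<open>1 - 2 * d\<close> would put \<open>p\<close> within less
    than \<open>6 * d = \<epsilon>\<close> of the product at \<open>(x, y)\<close>, contradicting
    the definition of \<open>\<epsilon>\<close>.\<close>
  define d where "d = \<epsilon> / 6"
  have "\<epsilon> \<le> 1"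
    unfolding \<epsilon>_def using mult_nonneg_nonneg[OF pmf_nonneg pmf_nonneg, of "map_pmf fst p" x "map_pmf snd p" y]
      mult_le_one[OF pmf_le_1 pmf_nonneg pmf_le_1, of "map_pmf fst p" x "map_pmf snd p" y]
      pmf_nonneg[of p "(x, y)"] pmf_le_1[of p "(x, y)"]
    by linarith
  then have d: "0 < d" "d < 1" using xy by (auto simp: d_def \<epsilon>_def)
  have rate: "code_rate P + ennreal (d / 2) \<le> shannon_entropy P + 1"
    if gen: "exactly_generated p P dX dY" for P :: "nat pmf" and dX dY
    using d
  proof (cases rule: balanced_set_or_large_atom[where P = P])
    case (1 S)
    then show ?thesis using d by (intro code_rate_add_le_entropy)
  next
    case (2 v)
    with simulated_pair_near_product[OF gen, of x y v] have False
      by (simp add: d_def flip: \<epsilon>_def)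
    then show ?thesis ..
  qed
  \<comment> \<open>Moving the 1 to the left leaves a bare infimum on the right, ready for
    \<open>INF_greatest\<close>.\<close>
  have "exact_common_information p + ennreal (d / 2) - 1 \<le> common_entropy p"
    unfolding common_entropy_def
  proof (rule INF_greatest)
    fix q :: "('a \<times> nat \<times> 'b) pmf"
    assume "q \<in> {q. map_pmf (\<lambda>(x, w, y). (x, y)) q = p \<and> markov_chain q}"
    then obtain dX dY where gen: "exactly_generated p (map_pmf (\<lambda>(x, w, y). w) q) dX dY"
      using exactly_generated_of_markov_chain by blast
    let ?P = "map_pmf (\<lambda>(x, w, y). w) q"
    have "exact_common_information p \<le> code_rate ?P"
      unfolding exact_common_information_def using gen by (intro INF_lower) auto
    then have "exact_common_information p + ennreal (d / 2) \<le> shannon_entropy ?P + 1"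
      using rate[OF gen] by (meson add_right_mono order_trans)
    then show "exact_common_information p + ennreal (d / 2) - 1 \<le> shannon_entropy ?P"
      by (subst ennreal_minus_le_iff) (auto simp: add.commute)
  qed
  then have "exact_common_information p + ennreal (d / 2) \<le> common_entropy p + 1"
    by (subst (asm) ennreal_minus_le_iff) (auto simp: add.commute)
  with d show ?thesis by (intro that[of "d / 2"]) auto
qed

theorem proposition1:
  fixes p :: "('a \<times> 'b) pmf" and A :: "'a set" and B :: "'b set"
  assumes "finite A" and "finite B" and "set_pmf p \<subseteq> A \<times> B"
  shows "common_entropy p \<le> exact_common_information p \<and>
         exact_common_information p < common_entropy p + 1"
proof
  show "common_entropy p \<le> exact_common_information p"
    by (rule common_entropy_le_exact_common_information)
  show "exact_common_information p < common_entropy p + 1"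
  proof (cases "p = pair_pmf (map_pmf fst p) (map_pmf snd p)")
    case True
    then have "exact_common_information p = 0" by (metis exact_common_information_pair_pmf)
    then show ?thesis by (simp add: add_pos_nonneg add.commute)
  next
    case False
    then obtain e :: real where e: "0 < e" "exact_common_information p + ennreal e \<le> common_entropy p + 1"
      by (rule exact_common_information_add_le)
    have "common_entropy p + 1 < \<top>"
      using common_entropy_finite[of p] assms by (auto intro: finite_subset)
    with e(2) have "exact_common_information p + ennreal e < \<top>" by (rule le_less_trans)
    \<comment> \<open>Adding \<open>e\<close> is a strict increase only below
      \<open>\<top>\<close>.\<close>
    then have "exact_common_information p < exact_common_information p + ennreal e"
      using e(1) by (cases "exact_common_information p") (auto simp: ennreal_lessI simp flip: ennreal_plus)
    with e(2) show ?thesis by (rule less_le_trans[rotated])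
  qed
qed

end
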